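(* Let $I\subset\mathbb{R}$ be an interval, let $f:I\to\mathbb{R}$ be differentiable on the interior $I^{\circ}$ with $f'\in L[a,b]$, where $a,b\in I^{\circ}$, $a<b$. Let $q>1$ and let $p$ satisfy $\frac1p+\frac1q=1$. If $|f'|^{q}$ is quasi-convex on $[a,b]$, then $$\left|\frac16\left[f(a)+4f\left(\frac{a+b}{2}\right)+f(b)\right]-\frac{1}{b-a}\int_a^b f(x)\,dx\right|$$ $$\le \frac{b-a}{12}\left(\frac{1+2^{p+1}}{3(p+1)}\right)^{1/p}\left\{\left(\sup\left\{\left|f'\left(\tfrac{a+b}{2}\right)\right|^q,|f'(a)|^q\right\}\right)^{1/q}+\left(\sup\left\{\left|f'\left(\tfrac{a+b}{2}\right)\right|^q,|f'(b)|^q\right\}\right)^{1/q}\right\}.$$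
   Context: A function $g:[a,b]\to\mathbb{R}$ is quasi-convex on $[a,b]$ if $g(tx+(1-t)y)\le\sup\{g(x),g(y)\}$ for all $x,y\in[a,b]$ and $t\in[0,1]$. $L[a,b]$ denotes the set of Lebesgue integrable functions on $[a,b]$. *)

theory Defs
  imports "HOL-Analysis.Analysis"
begin

(* As in the library's convex_on, convexity of the domain is part of the notion;
   it holds trivially for a closed interval. *)
definition quasi_convex_on :: "'a::real_vector set \<Rightarrow> ('a \<Rightarrow> real) \<Rightarrow> bool" where
  "quasi_convex_on S g \<longleftrightarrow> convex S \<and>
    (\<forall>x\<in>S. \<forall>y\<in>S. \<forall>t\<in>{0..1}. g (t *\<^sub>R x + (1 - t) *\<^sub>R y) \<le> Sup {g x, g y})"

end

(* On each half of [a,b], quasi-convexity bounds |f'| by its endpoint supremum M, so f is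
   M-Lipschitz there. Comparing f on [a, a+(b-a)/6] with f(a) and on [a+(b-a)/6, (a+b)/2] with
   f((a+b)/2) (and symmetrically on the right half) gives the Simpson estimate with the constant
   (5/72)(b-a). Since 5/6 is the mean of |u| over [-1,2], and (1+2^(p+1))/(3(p+1)) is the mean of
   |u|^p, the stated constant is larger by monotonicity of power means. *)
theory Submission
  imports Defs
begin

text \<open>Convexity of the power on the open half-line keeps its graph above the tangent at
  \<open>c\<close>. This is the pointwise form of the power mean comparison.\<close>

lemma powr_ge_tangent:
  fixes u c p :: real
  assumes "u > 0" "c > 0" "p \<ge> 1"
  shows "c powr p + p * c powr (p - 1) * (u - c) \<le> u powr p"
proof -
  have "p * c powr (p - 1) * (u - c) \<le> u powr p - c powr p"
  proof (rule convex_on_imp_above_tangent)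
    show "convex_on {0<..} (\<lambda>x::real. x powr p)"
      using assms(3) by (rule powr_convex)
    show "((\<lambda>x. x powr p) has_real_derivative p * c powr (p - 1)) (at c within {0<..})"
      using assms(2) by (auto intro!: derivative_eq_intros)
  qed (use assms in \<open>auto simp: interior_open\<close>)
  then show ?thesis by simp
qed

text \<open>The tangent inequality integrated over \<open>{0..v}\<close>: the difference
  \<open>G\<close> of the two antiderivatives vanishes at 0 and has nonnegative derivative. The
  tangent bound holds only for \<open>u > 0\<close>, so the derivative is tested on the open
  interval and continuity covers the endpoint 0.\<close>

lemma powr_tangent_antiderivative:
  fixes c p v :: real
  assumes "c > 0" "p \<ge> 1" "v \<ge> 0"
  shows "c powr p * v + p * c powr (p - 1) * (v\<^sup>2 / 2 - c * v) \<le> v powr (p + 1) / (p + 1)"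
proof -
  define G where "G = (\<lambda>u::real. u powr (p + 1) / (p + 1) - c powr p * u
    - p * c powr (p - 1) * (u\<^sup>2 / 2 - c * u))"
  have "G 0 \<le> G v"
  proof (rule DERIV_nonneg_imp_increasing_open[OF \<open>0 \<le> v\<close>])
    fix u :: real assume u: "0 < u" "u < v"
    have "(G has_real_derivative u powr p - c powr p - p * c powr (p - 1) * (u - c)) (at u)"
      unfolding G_def using u assms
      by (auto intro!: derivative_eq_intros simp: power2_eq_square)
    with powr_ge_tangent[OF u(1) assms(1,2)]
    show "\<exists>y. (G has_real_derivative y) (at u) \<and> 0 \<le> y" by force
  next
    show "continuous_on {0..v} G"
      unfolding G_def using assms by (intro continuous_intros continuous_on_powr') auto
  qed
  then show ?thesis using assms by (simp add: G_def)
qed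

lemma simpson_constant_ge:
  fixes p :: real
  assumes "p \<ge> 1"
  shows "5 / 6 \<le> ((1 + 2 powr (p + 1)) / (3 * (p + 1))) powr (1 / p)"
proof -
  let ?A = "(1 + 2 powr (p + 1)) / (3 * (p + 1))"
  \<comment> \<open>The cases \<open>v = 1\<close> and \<open>v = 2\<close> are the two pieces of
    the integral of |u|^p over [-1,2], split at 0. With c = 5/6 the slope terms (1/2 - c) + (2 - 2c)
    cancel, leaving only 3 c^p on the left.\<close>
  have "3 * (5 / 6 :: real) powr p \<le> 1 / (p + 1) + 2 powr (p + 1) / (p + 1)"
    using powr_tangent_antiderivative[of "5/6" p 1] powr_tangent_antiderivative[of "5/6" p 2] assms
    by (simp add: algebra_simps)
  also have "\<dots> = 3 * ?A" using assms by (simp add: field_simps)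
  finally have "(5 / 6) powr p \<le> ?A" by linarith
  then have "((5 / 6) powr p) powr (1 / p) \<le> ?A powr (1 / p)"
    using assms by (intro powr_mono2) auto
  then show ?thesis using assms by (simp add: powr_powr)
qed

lemma integral_endpoint_bound:
  fixes f :: "real \<Rightarrow> real"
  assumes "u \<le> v" "w = u \<or> w = v"
    and cont: "continuous_on {u..v} f"
    and lip: "\<And>x. x \<in> {u..v} \<Longrightarrow> \<bar>f x - f w\<bar> \<le> M * \<bar>x - w\<bar>"
  shows "\<bar>integral {u..v} f - (v - u) * f w\<bar> \<le> M * (v - u)\<^sup>2 / 2"
proof -
  \<comment> \<open>Since \<open>w\<close> is an endpoint, \<open>x - w\<close> keeps one sign on
    the interval. The factor \<open>s\<close> records it, so that the bound
    \<open>M * \<bar>x - w\<bar>\<close> becomes linear and has an explicit integral.\<close>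
  define s :: real where "s = (if w = u then 1 else -1)"
  have s: "M * \<bar>x - w\<bar> = s * M * (x - w)" if "x \<in> {u..v}" for x
    using that assms(2) by (auto simp: s_def)
  have "((\<lambda>x. s * M * (x - w)) has_integral s * M * (v - w)\<^sup>2 / 2 - s * M * (u - w)\<^sup>2 / 2) {u..v}"
    by (rule fundamental_theorem_of_calculus[OF \<open>u \<le> v\<close>])
      (auto intro!: derivative_eq_intros simp flip: has_real_derivative_iff_has_vector_derivative)
  moreover have "s * M * (v - w)\<^sup>2 / 2 - s * M * (u - w)\<^sup>2 / 2 = M * (v - u)\<^sup>2 / 2"
    using assms(2) by (auto simp: s_def power2_commute)
  ultimately have lin: "((\<lambda>x. s * M * (x - w)) has_integral M * (v - u)\<^sup>2 / 2) {u..v}"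
    by simp
  have "norm (integral {u..v} (\<lambda>x. f x - f w)) \<le> integral {u..v} (\<lambda>x. s * M * (x - w))"
    using lip s cont lin
    by (intro integral_norm_bound_integral integrable_continuous_interval continuous_intros) auto
  also have "\<dots> = M * (v - u)\<^sup>2 / 2"
    using lin by (rule integral_unique)
  also have "integral {u..v} (\<lambda>x. f x - f w) = integral {u..v} f - (v - u) * f w"
    using \<open>u \<le> v\<close> by (subst integral_diff) (auto intro: integrable_continuous_interval cont)
  finally show ?thesis by simp
qed

text \<open>The bound on the derivative makes \<open>f\<close> Lipschitz with constant
  \<open>M\<close>. Left of \<open>c\<close> the function is compared with its value at
  \<open>u\<close>, right of \<open>c\<close> with its value at \<open>v\<close>, so the choice of
  \<open>c\<close> sets the weights of the quadrature rule.\<close>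

lemma integral_two_point_bound:
  fixes f :: "real \<Rightarrow> real"
  assumes "u \<le> c" "c \<le> v"
    and deriv: "\<And>x. x \<in> {u..v} \<Longrightarrow> (f has_real_derivative f' x) (at x)"
    and bound: "\<And>x. x \<in> {u..v} \<Longrightarrow> \<bar>f' x\<bar> \<le> M"
  shows "\<bar>(c - u) * f u + (v - c) * f v - integral {u..v} f\<bar> \<le> M * ((c - u)\<^sup>2 + (v - c)\<^sup>2) / 2"
proof -
  have cont: "continuous_on {u..v} f"
    using deriv by (meson DERIV_isCont continuous_at_imp_continuous_on)
  have lip: "\<bar>f x - f w\<bar> \<le> M * \<bar>x - w\<bar>" if "x \<in> {u..v}" "w \<in> {u..v}" for x w
    using field_differentiable_bound[of "{u..v}" f f' M x w] that deriv bound
    by (auto intro: has_field_derivative_at_within)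
  have "\<bar>integral {u..c} f - (c - u) * f u\<bar> \<le> M * (c - u)\<^sup>2 / 2"
    using assms(1,2)
    by (intro integral_endpoint_bound continuous_on_subset[OF cont] lip) auto
  moreover have "\<bar>integral {c..v} f - (v - c) * f v\<bar> \<le> M * (v - c)\<^sup>2 / 2"
    using assms(1,2)
    by (intro integral_endpoint_bound continuous_on_subset[OF cont] lip) auto
  moreover have "integral {u..c} f + integral {c..v} f = integral {u..v} f"
    using assms(1,2) by (intro Henstock_Kurzweil_Integration.integral_combine
        integrable_continuous_interval cont)
  ultimately show ?thesis unfolding abs_le_iff by (simp add: algebra_simps)
qed

lemma quasi_convex_on_closed_segment:
  assumes "quasi_convex_on S g" "x \<in> S" "y \<in> S" "z \<in> closed_segment x y"
  shows "g z \<le> Sup {g y, g x}"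
proof -
  obtain t where "z = (1 - t) *\<^sub>R x + t *\<^sub>R y" "t \<in> {0..1}"
    using assms(4) by (auto simp: in_segment)
  then show ?thesis
    using assms(1-3) unfolding quasi_convex_on_def by (metis add.commute)
qed

text \<open>Taking the \<open>q\<close>-th root of the quasi-convexity bound. A closed segment
  ignores the order of its endpoints, so with the midpoint as \<open>y\<close> one statement serves
  both halves and yields the suprema in the order used by the theorem.\<close>

lemma quasi_convex_on_powr_bound:
  fixes g :: "real \<Rightarrow> real"
  assumes "quasi_convex_on S (\<lambda>x. \<bar>g x\<bar> powr q)" "q > 0"
    and "x \<in> S" "y \<in> S" "z \<in> closed_segment x y"
  shows "\<bar>g z\<bar> \<le> (Sup {\<bar>g y\<bar> powr q, \<bar>g x\<bar> powr q}) powr (1 / q)"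
proof -
  have "(\<bar>g z\<bar> powr q) powr (1 / q) \<le> (Sup {\<bar>g y\<bar> powr q, \<bar>g x\<bar> powr q}) powr (1 / q)"
    using quasi_convex_on_closed_segment[OF assms(1,3-5)] assms(2) by (intro powr_mono2) auto
  then show ?thesis using assms(2) by (simp add: powr_powr)
qed

theorem corollary8:
  fixes I :: "real set" and f :: "real \<Rightarrow> real" and a b p q :: real
  assumes "is_interval I"
    and "\<forall>x\<in>interior I. f differentiable (at x)"
    and "a \<in> interior I" and "b \<in> interior I" and "a < b"
    and "deriv f absolutely_integrable_on {a..b}"
    and "q > 1" and "1 / p + 1 / q = 1"
    and "quasi_convex_on {a..b} (\<lambda>x. \<bar>deriv f x\<bar> powr q)"
  shows "\<bar>1 / 6 * (f a + 4 * f ((a + b) / 2) + f b) - 1 / (b - a) * integral {a..b} f\<bar>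
    \<le> (b - a) / 12 * ((1 + 2 powr (p + 1)) / (3 * (p + 1))) powr (1 / p) *
      ((Sup {\<bar>deriv f ((a + b) / 2)\<bar> powr q, \<bar>deriv f a\<bar> powr q}) powr (1 / q)
       + (Sup {\<bar>deriv f ((a + b) / 2)\<bar> powr q, \<bar>deriv f b\<bar> powr q}) powr (1 / q))"
    (is "\<bar>?E\<bar> \<le> _ / 12 * ?C * (?M + ?N)")
proof -
  define m where "m = (a + b) / 2"
  \<comment> \<open>In this unit the Simpson weights, multiplied by \<open>b - a\<close>, are
    \<open>h\<close>, \<open>4 * h\<close> and \<open>h\<close>. Each half of the interval takes
    \<open>2 * h\<close> of the middle weight.\<close>
  define h where "h = (b - a) / 6"
  have m: "m = a + 3 * h" and b: "b = a + 6 * h" and "h > 0"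
    using \<open>a < b\<close> by (auto simp: m_def h_def field_simps)
  \<comment> \<open>Conjugacy places \<open>1 / p\<close> strictly between 0 and 1, which excludes
    \<open>p \<le> 0\<close>, including the value \<open>1 / 0 = 0\<close>.\<close>
  have "0 < 1 / q" "1 / q < 1"
    using assms(7) by auto
  then have "0 < 1 / p" "1 / p < 1"
    using assms(8) by linarith+
  then have "p \<ge> 1" by (simp add: field_simps split: if_splits)
  have sub: "{a..b} \<subseteq> interior I"
    using assms(1,3,4) by (metis closed_segment_eq_real_ivl1 closed_segment_subset convex_interior
        is_interval_convex_1 \<open>a < b\<close> less_imp_le)
  have deriv: "(f has_real_derivative deriv f x) (at x)" if "x \<in> {a..b}" for x
    using assms(2) sub that by (meson DERIV_deriv_iff_real_differentiable subsetD)
  have M: "\<bar>deriv f x\<bar> \<le> ?M" if "x \<in> {a..m}" for x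
    using quasi_convex_on_powr_bound[OF assms(9), of a m x] assms(7) that m b \<open>h > 0\<close>
    by (auto simp: closed_segment_eq_real_ivl m_def)
  have N: "\<bar>deriv f x\<bar> \<le> ?N" if "x \<in> {m..b}" for x
    using quasi_convex_on_powr_bound[OF assms(9), of b m x] assms(7) that m b \<open>h > 0\<close>
    by (auto simp: closed_segment_eq_real_ivl m_def)
  \<comment> \<open>Splitting at \<open>a + h\<close> produces the weights \<open>h\<close> and
    \<open>2 * h\<close>, with error factor h^2 + (2h)^2 = 5 h^2. The right half is the mirror
    image, split at \<open>a + 5 * h\<close>.\<close>
  have 1: "\<bar>h * f a + 2 * h * f m - integral {a..m} f\<bar> \<le> ?M * (5 * h\<^sup>2) / 2"
    using integral_two_point_bound[of a "a + h" m f "deriv f" ?M] deriv M m b \<open>h > 0\<close>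
    by (simp add: algebra_simps power2_eq_square)
  have 2: "\<bar>2 * h * f m + h * f b - integral {m..b} f\<bar> \<le> ?N * (5 * h\<^sup>2) / 2"
    using integral_two_point_bound[of m "a + 5 * h" b f "deriv f" ?N] deriv N m b \<open>h > 0\<close>
    by (simp add: algebra_simps power2_eq_square)
  have "continuous_on {a..b} f"
    using deriv by (meson DERIV_isCont continuous_at_imp_continuous_on)
  then have 3: "integral {a..m} f + integral {m..b} f = integral {a..b} f"
    using m b \<open>h > 0\<close>
    by (intro Henstock_Kurzweil_Integration.integral_combine integrable_continuous_interval) auto
  \<comment> \<open>Multiplying by \<open>6 * h\<close>, which is \<open>b - a\<close>, turns the
    Simpson error into the sum of the two errors bounded in \<open>1\<close> and
    \<open>2\<close>.\<close>
  have E: "6 * h * ?E = h * f a + 4 * h * f m + h * f b - integral {a..b} f"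
    unfolding m_def[symmetric] using \<open>h > 0\<close> by (simp add: b field_simps)
  have "6 * h * \<bar>?E\<bar> = \<bar>6 * h * ?E\<bar>" using \<open>h > 0\<close> by (simp add: abs_mult)
  also have "\<dots> \<le> 5 / 2 * h\<^sup>2 * (?M + ?N)"
    unfolding E using 1 2 3 unfolding abs_le_iff by (simp add: algebra_simps)
  \<comment> \<open>The bound is factored so that \<open>5 / 6\<close> stands exactly where
    \<open>?C\<close> is to replace it.\<close>
  also have "\<dots> = 6 * h * (h / 2 * (5 / 6) * (?M + ?N))"
    by (simp add: power2_eq_square)
  finally have "\<bar>?E\<bar> \<le> h / 2 * (5 / 6) * (?M + ?N)"
    using \<open>h > 0\<close> by (simp only: mult_le_cancel_left_pos mult_pos_pos zero_less_numeral)
  also have "\<dots> \<le> h / 2 * ?C * (?M + ?N)"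
    using simpson_constant_ge[OF \<open>p \<ge> 1\<close>] \<open>h > 0\<close>
    by (intro mult_right_mono mult_left_mono) auto
  also have "h / 2 = (b - a) / 12" by (simp add: h_def)
  finally show ?thesis .
qed

end
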